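(* Take $N=\mathbb I_D$. For $k\ge0$ the second kind functions evaluated at $q=(q_1,\dots,q_D)$ are $$C_{[k]}(q)=(-1)^{k+D}\sum_{1\le a_1\le\cdots\le a_k\le D}\rho^{(a_k)}_{[k]}\cdots\rho^{(a_1)}_{[1]}\,T^{-1}H_{[0]},$$ or, in terms of quasi-tau matrices and their inverse translations, $$\begin{aligned}C_{[k]}(q)=(-1)^{k+D}\sum_{1\le a_1\le\cdots\le a_k\le D}&\Big(\prod_{j=a_k}^DT_j^{-1}H_{[k]}\Big)(\Lambda_{a_k})_{[k-1],[k]}^\top\Big(\prod_{j=a_k+1}^DT_j^{-1}H_{[k-1]}\Big)^{-1}\cdots\\&\times\Big(\prod_{j=a_1}^DT_j^{-1}H_{[1]}\Big)(\Lambda_{a_1})_{[0],[1]}^\top\Big(\prod_{j=a_1+1}^DT_j^{-1}H_{[0]}\Big)^{-1}T^{-1}H_{[0]}.\end{aligned}$$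
   Context: Let $D\ge 1$. For $k\in\mathbb Z_+$ let $[k]=\{\alpha\in\mathbb Z_+^D:|\alpha|=k\}$, ordered so that $\alpha>\alpha'$ iff at the first coordinate where they differ the entry of $\alpha$ is smaller. $\chi_{[k]}(x)$ is the column vector of monomials $x^\alpha$, $\alpha\in[k]$, and $\chi$ stacks $\chi_{[0]},\chi_{[1]},\dots$; $\chi^*(x)=\big(\prod_ax_a^{-1}\big)\chi(x_1^{-1},\dots,x_D^{-1})$. Semi-infinite matrices are partitioned in blocks $A_{[k],[\ell]}\in\mathbb R^{|[k]|\times|[\ell]|}$. Shift matrices: $\Lambda_a$ has as only nonzero blocks $(\Lambda_a)_{[k],[k+1]}$, with entries $\delta_{\alpha+e_a,\alpha'}$, $\alpha\in[k]$, $\alpha'\in[k+1]$. Discrete flows (case $N=\mathbb I_D$): fix $q\in\mathbb R^D$ with all $q_a\ne0$. Let $\mu$ be a Borel measure with finite moments and $\operatorname{supp}\mu\subset\{x:|x_a|<|q_a|,\ a=1,\dots,D\}$. For $m\in\mathbb Z^D$, $d\mu_m(x)=\big[\prod_a(x_a-q_a)^{m_a}\big]d\mu(x)$ has moment matrix $G(m)=\int\chi\,d\mu_m\,\chi^\top$, and it is assumed that for each $m$, $G(m)=S(m)^{-1}H(m)(S(m)^{-1})^\top$ with $S(m)$ block lower triangular with identity diagonal blocks and $H(m)=\operatorname{diag}(H_{[0]}(m),H_{[1]}(m),\dots)$ with invertible blocks (the quasi-tau matrices). $(T_af)(m)=f(m+e_a)$, $T=\prod_{a=1}^DT_a$; in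 the formulas $\prod_{j=a}^DT_j^{-1}H_{[k]}$ means the composed translation $\big(\prod_{j=a}^DT_j^{-1}\big)(H_{[k]})$, an empty product being the identity. The dependence on $m$ is omitted. Second kind functions: $C=H(S^{-1})^\top\chi^*$ (Laurent series), for the measure $\mu_m$, with blocks $C_{[k]}$. $\rho_{a,[k]}=H_{[k]}\big[(\Lambda_a)_{[k-1],[k]}\big]^\top(T_aH_{[k-1]})^{-1}$ and $\rho^{(a)}_{[k]}=\big(\prod_{j=a}^DT_j^{-1}\big)(\rho_{a,[k]})$, for $k\ge1$. *)

theory Defs
  imports "HOL-Analysis.Analysis"
begin

text \<open>
  The coordinates are indexed by a finite linearly ordered type \<open>'d\<close>, so that \<open>D = CARD('d) \<ge> 1\<close>.
  Multi-indices are elements of \<open>nat ^ 'd\<close>. Rows and columns of the semi-infinite matrices are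
  labelled by the multi-indices themselves instead of by their position in a graded ordering: all
  operations below depend only on the partition into the levels \<open>[k]\<close>, and permuting the
  multi-indices inside the levels does not affect them.
\<close>

type_synonym 'd smat = "nat ^ 'd \<Rightarrow> nat ^ 'd \<Rightarrow> real"

definition mdeg :: "nat ^ 'd \<Rightarrow> nat"
  where "mdeg \<alpha> = (\<Sum>a\<in>UNIV. \<alpha> $ a)"

definition level :: "nat \<Rightarrow> (nat ^ 'd) set"
  where "level k = {\<alpha>. mdeg \<alpha> = k}"

text \<open>The entry of \<open>\<chi>(x)\<close> at \<open>\<alpha>\<close> is the monomial \<open>x\<^sup>\<alpha>\<close>.\<close>

definition chi :: "real ^ 'd \<Rightarrow> nat ^ 'd \<Rightarrow> real"
  where "chi x \<alpha> = (\<Prod>a\<in>UNIV. (x $ a) ^ (\<alpha> $ a))"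

definition chi_star :: "real ^ 'd \<Rightarrow> nat ^ 'd \<Rightarrow> real"
  where "chi_star x \<alpha> = (\<Prod>a\<in>UNIV. inverse (x $ a)) * chi (\<chi> a. inverse (x $ a)) \<alpha>"

text \<open>
  In every use of \<open>mmul\<close> below each entry is a sum with only finitely many nonzero terms
  (block triangularity or block support), so the infinite sum is the ordinary matrix product.
\<close>

definition mmul :: "('d::finite) smat \<Rightarrow> 'd smat \<Rightarrow> 'd smat"  (infixl "\<odot>" 70)
  where "A \<odot> B = (\<lambda>\<alpha> \<gamma>. \<Sum>\<^sub>\<infinity>\<beta>. A \<alpha> \<beta> * B \<beta> \<gamma>)"

definition mtrans :: "('d::finite) smat \<Rightarrow> 'd smat"
  where "mtrans A = (\<lambda>\<alpha> \<beta>. A \<beta> \<alpha>)"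

definition mone :: "('d::finite) smat"
  where "mone = (\<lambda>\<alpha> \<beta>. if \<alpha> = \<beta> then 1 else 0)"

text \<open>
  The block \<open>A\<^bsub>[k],[l]\<^esub>\<close> is represented by the matrix that agrees with \<open>A\<close> on \<open>[k] \<times> [l]\<close> and
  vanishes elsewhere; with this padding \<open>\<odot>\<close> is the product of blocks. The inverse of a diagonal
  block is taken among the matrices supported on \<open>[k] \<times> [k]\<close>.
\<close>

definition blk :: "nat \<Rightarrow> nat \<Rightarrow> ('d::finite) smat \<Rightarrow> 'd smat"
  where "blk k l A = (\<lambda>\<alpha> \<beta>. if \<alpha> \<in> level k \<and> \<beta> \<in> level l then A \<alpha> \<beta> else 0)"

definition is_blk_inv :: "nat \<Rightarrow> ('d::finite) smat \<Rightarrow> 'd smat \<Rightarrow> bool"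
  where "is_blk_inv k A B \<longleftrightarrow>
    blk k k B = B \<and> blk k k A \<odot> B = blk k k mone \<and> B \<odot> blk k k A = blk k k mone"

definition blk_inv :: "nat \<Rightarrow> ('d::finite) smat \<Rightarrow> 'd smat"
  where "blk_inv k A = (THE B. is_blk_inv k A B)"

definition block_lower_unitriangular :: "('d::finite) smat \<Rightarrow> bool"
  where "block_lower_unitriangular S \<longleftrightarrow>
    (\<forall>\<alpha> \<beta>. mdeg \<alpha> \<le> mdeg \<beta> \<longrightarrow> S \<alpha> \<beta> = mone \<alpha> \<beta>)"

definition block_diagonal :: "('d::finite) smat \<Rightarrow> bool"
  where "block_diagonal H \<longleftrightarrow> (\<forall>\<alpha> \<beta>. mdeg \<alpha> \<noteq> mdeg \<beta> \<longrightarrow> H \<alpha> \<beta> = 0)"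

text \<open>The inverse in the group of block lower unitriangular matrices.\<close>

definition lower_inv :: "('d::finite) smat \<Rightarrow> 'd smat"
  where "lower_inv S =
    (THE L. block_lower_unitriangular L \<and> S \<odot> L = mone \<and> L \<odot> S = mone)"

definition block_factorization :: "('d::finite) smat \<Rightarrow> 'd smat \<Rightarrow> 'd smat \<Rightarrow> bool"
  where "block_factorization G S H \<longleftrightarrow>
    block_lower_unitriangular S \<and> block_diagonal H \<and> (\<forall>k. \<exists>B. is_blk_inv k H B) \<and>
    G = lower_inv S \<odot> H \<odot> mtrans (lower_inv S)"

definition Lam :: "('d::finite) \<Rightarrow> 'd smat"
  where "Lam a = (\<lambda>\<alpha> \<beta>. if \<alpha> + axis a 1 = \<beta> then 1 else 0)"

definition msupp :: "(real ^ 'd) measure \<Rightarrow> (real ^ 'd) set"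
  where "msupp M = {x. \<forall>U. open U \<and> x \<in> U \<longrightarrow> emeasure M U > 0}"

text \<open>
  The weight \<open>\<Prod>\<^sub>a (x\<^sub>a - q\<^sub>a)\<^bsup>m\<^sub>a\<^esup>\<close> can be negative, so \<open>\<mu>\<^sub>m\<close> enters through integrals against the
  weight.
\<close>

definition moment_matrix :: "(real ^ 'd) measure \<Rightarrow> real ^ 'd \<Rightarrow> int ^ 'd \<Rightarrow> 'd smat"
  where "moment_matrix M q m = (\<lambda>\<alpha> \<beta>.
    LINT x|M. (\<Prod>a\<in>UNIV. (x $ a - q $ a) powi (m $ a)) * (chi x \<alpha> * chi x \<beta>))"

text \<open>
  \<open>Tr a\<close> is \<open>T\<^sub>a\<close> and \<open>Tinv J\<close> is \<open>\<Prod>\<^bsub>j\<in>J\<^esub> T\<^sub>j\<^bsup>-1\<^esup>\<close>. In particular \<open>Tinv {a..}\<close> and \<open>Tinv {a<..}\<close> are the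
  products over \<open>j = a, \<dots>, D\<close> and \<open>j = a + 1, \<dots>, D\<close>, and \<open>Tinv UNIV\<close> is \<open>T\<^bsup>-1\<^esup>\<close>.
\<close>

definition Tr :: "'d \<Rightarrow> (int ^ 'd \<Rightarrow> 'b) \<Rightarrow> int ^ 'd \<Rightarrow> 'b"
  where "Tr a f = (\<lambda>m. f (m + axis a 1))"

definition Tinv :: "'d set \<Rightarrow> (int ^ 'd \<Rightarrow> 'b) \<Rightarrow> int ^ 'd \<Rightarrow> 'b"
  where "Tinv J f = (\<lambda>m. f (m - (\<Sum>j\<in>J. axis j 1)))"

lemma Tinv_empty: "Tinv {} f = f"
  by (simp add: Tinv_def)

lemma Tinv_single_Tr: "Tinv {a} (Tr a f) = f" "Tr a (Tinv {a} f) = f"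
  by (simp_all add: Tinv_def Tr_def)

lemma Tinv_insert: "a \<notin> J \<Longrightarrow> Tinv (insert a J) f = Tinv {a} (Tinv J f)"
  by (simp add: Tinv_def algebra_simps)

definition Hblk :: "(int ^ 'd \<Rightarrow> 'd smat) \<Rightarrow> nat \<Rightarrow> int ^ 'd \<Rightarrow> 'd smat"
  where "Hblk H k = (\<lambda>m. blk k k (H m))"

text \<open>The function \<open>rho H a k\<close> is only meant for \<open>k \<ge> 1\<close>.\<close>

definition rho :: "(int ^ 'd \<Rightarrow> 'd smat) \<Rightarrow> 'd \<Rightarrow> nat \<Rightarrow> int ^ 'd \<Rightarrow> 'd smat"
  where "rho H a k = (\<lambda>m.
    Hblk H k m \<odot> mtrans (blk (k - 1) k (Lam a)) \<odot> blk_inv (k - 1) (Tr a (Hblk H (k - 1)) m))"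

definition rho_shift ::
    "(int ^ 'd::{finite,linorder} \<Rightarrow> 'd smat) \<Rightarrow> 'd \<Rightarrow> nat \<Rightarrow> int ^ 'd::{finite,linorder} \<Rightarrow> 'd smat"
  where "rho_shift H a k = Tinv {a..} (rho H a k)"

text \<open>\<open>desc_prod F k B\<close> is the product \<open>F k \<cdots> F 1 B\<close>.\<close>

primrec desc_prod :: "(nat \<Rightarrow> ('d::finite) smat) \<Rightarrow> nat \<Rightarrow> 'd smat \<Rightarrow> 'd smat"
  where
    "desc_prod F 0 B = B"
  | "desc_prod F (Suc k) B = F (Suc k) \<odot> desc_prod F k B"

text \<open>
  The Laurent series \<open>C = H (S\<^bsup>-1\<^esup>)\<^sup>\<top> \<chi>\<^sup>*\<close>, given by its terms at the point \<open>z\<close>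
  and by its sum.
\<close>

definition second_kind_term ::
    "'d smat \<Rightarrow> 'd smat \<Rightarrow> real ^ 'd \<Rightarrow> nat ^ 'd \<Rightarrow> nat ^ 'd \<Rightarrow> real"
  where "second_kind_term S H z \<alpha> \<beta> = (H \<odot> mtrans (lower_inv S)) \<alpha> \<beta> * chi_star z \<beta>"

definition second_kind :: "'d smat \<Rightarrow> 'd smat \<Rightarrow> real ^ 'd \<Rightarrow> nat ^ 'd \<Rightarrow> real"
  where "second_kind S H z \<alpha> = (\<Sum>\<^sub>\<infinity>\<beta>. second_kind_term S H z \<alpha> \<beta>)"

text \<open>
  The tuples \<open>1 \<le> a\<^sub>1 \<le> \<cdots> \<le> a\<^sub>k \<le> D\<close>; the entry \<open>a\<^sub>j\<close> of such a list \<open>as\<close> is \<open>as ! (j - 1)\<close>.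
\<close>

definition weakly_increasing :: "nat \<Rightarrow> ('d::linorder) list set"
  where "weakly_increasing k = {as. length as = k \<and> sorted as}"

end

theory Submission
  imports Defs
begin

text \<open>
  Since \<open>C = H (S\<^sup>-\<^sup>1)\<^sup>\<top> \<chi>\<^sup>* = S G \<chi>\<^sup>*\<close>, summing the geometric series under the integral shows that \<open>C(q)\<close> is
  \<open>(-1)\<^sup>D\<close> times the column \<open>0\<close> of \<open>S(m) G(m')\<close>, where \<open>m' = m - (1, \<dots>, 1)\<close>. The relation
  \<open>G(n + e\<^sub>a) = G(n) (\<Lambda>\<^sub>a\<^sup>\<top> - q\<^sub>a)\<close> and the triangularity of \<open>S\<close> give the connection formula
  \<open>S\<^bsub>[k]\<^esub>(n) = S\<^bsub>[k]\<^esub>(n + e\<^sub>a) + \<rho>\<^bsub>a,[k]\<^esub>(n) S\<^bsub>[k-1]\<^esub>(n + e\<^sub>a)\<close> for the block rows of \<open>S\<close>. Lowering the coordinates \<open>D, D - 1, \<dots>\<close>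
  one after the other leads from \<open>S\<^bsub>[k]\<^esub>(m)\<close> to \<open>S\<^bsub>[k]\<^esub>(m')\<close>, which is orthogonal to the constants for \<open>k > 0\<close>, so only
  the \<open>\<rho>\<close> terms survive, and iterating over \<open>k\<close> yields the sum over weakly increasing tuples.
\<close>

subsection \<open>Row-finite matrices and block inverses\<close>

text \<open>Row-finiteness of the left factor turns every entry of a product into a finite sum.
  Associativity then asks nothing of the last factor, which may be a moment matrix with full
  rows.\<close>

definition row_finite :: "('d::finite) smat \<Rightarrow> bool"
  where "row_finite A \<longleftrightarrow> (\<forall>\<alpha>. finite {\<beta>. A \<alpha> \<beta> \<noteq> 0})"

lemma finite_mdeg_le: "finite {\<beta> :: nat ^ 'd::finite. mdeg \<beta> \<le> n}"
proof -
  have "{\<beta> :: nat ^ 'd. mdeg \<beta> \<le> n} \<subseteq> vec_lambda ` (UNIV \<rightarrow>\<^sub>E {..n})"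
  proof
    fix \<beta> :: "nat ^ 'd"
    assume "\<beta> \<in> {\<beta>. mdeg \<beta> \<le> n}"
    then have "\<beta> $ a \<le> n" for a
      using member_le_sum[of a UNIV "vec_nth \<beta>"] by (simp add: mdeg_def)
    then have "vec_nth \<beta> \<in> UNIV \<rightarrow>\<^sub>E {..n}"
      by auto
    then show "\<beta> \<in> vec_lambda ` (UNIV \<rightarrow>\<^sub>E {..n})"
      by (metis image_eqI vec_nth_inverse)
  qed
  then show ?thesis
    by (rule finite_subset) (intro finite_imageI finite_PiE; simp)
qed

lemma row_finiteI_mdeg: "(\<And>\<alpha> \<beta>. f \<alpha> < mdeg \<beta> \<Longrightarrow> A \<alpha> \<beta> = 0) \<Longrightarrow> row_finite A"
  unfolding row_finite_def by (metis (mono_tags, lifting) finite_mdeg_le finite_subset mem_Collect_eq not_le subsetI)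

lemma mmul_eq_sum:
  assumes "finite F" "\<And>\<beta>. \<beta> \<notin> F \<Longrightarrow> A \<alpha> \<beta> * B \<beta> \<gamma> = 0"
  shows "(A \<odot> B) \<alpha> \<gamma> = (\<Sum>\<beta>\<in>F. A \<alpha> \<beta> * B \<beta> \<gamma>)"
  unfolding mmul_def
  using infsum_cong_neutral[of F UNIV "\<lambda>\<beta>. A \<alpha> \<beta> * B \<beta> \<gamma>" "\<lambda>\<beta>. A \<alpha> \<beta> * B \<beta> \<gamma>"] assms by auto

lemma mmul_row_sum:
  assumes "row_finite A"
  shows "(A \<odot> B) \<alpha> \<gamma> = (\<Sum>\<beta> | A \<alpha> \<beta> \<noteq> 0. A \<alpha> \<beta> * B \<beta> \<gamma>)"
  using assms by (intro mmul_eq_sum) (auto simp: row_finite_def)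

lemma row_finite_mmul:
  assumes "row_finite A" "row_finite B"
  shows "row_finite (A \<odot> B)"
  unfolding row_finite_def
proof
  fix \<alpha>
  have "{\<gamma>. (A \<odot> B) \<alpha> \<gamma> \<noteq> 0} \<subseteq> (\<Union>\<beta>\<in>{\<beta>. A \<alpha> \<beta> \<noteq> 0}. {\<gamma>. B \<beta> \<gamma> \<noteq> 0})"
    unfolding mmul_row_sum[OF assms(1)] by (auto elim!: sum.not_neutral_contains_not_neutral)
  then show "finite {\<gamma>. (A \<odot> B) \<alpha> \<gamma> \<noteq> 0}"
    by (rule finite_subset) (use assms in \<open>auto simp: row_finite_def\<close>)
qed

lemma mmul_assoc:
  assumes "row_finite A" "row_finite B"
  shows "(A \<odot> B) \<odot> C = A \<odot> (B \<odot> C)"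
proof (intro ext)
  fix \<alpha> \<delta>
  let ?F = "{\<beta>. A \<alpha> \<beta> \<noteq> 0}"
  let ?E = "\<Union>\<beta>\<in>?F. {\<gamma>. B \<beta> \<gamma> \<noteq> 0}"
  have E: "finite ?E" and F: "finite ?F"
    using assms by (auto simp: row_finite_def)
  have AB: "(A \<odot> B) \<alpha> \<gamma> = (\<Sum>\<beta>\<in>?F. A \<alpha> \<beta> * B \<beta> \<gamma>)" for \<gamma>
    by (rule mmul_row_sum[OF assms(1)])
  have BC: "(B \<odot> C) \<beta> \<delta> = (\<Sum>\<gamma>\<in>?E. B \<beta> \<gamma> * C \<gamma> \<delta>)" if "\<beta> \<in> ?F" for \<beta>
    using that by (intro mmul_eq_sum E) auto
  have "((A \<odot> B) \<odot> C) \<alpha> \<delta> = (\<Sum>\<gamma>\<in>?E. (A \<odot> B) \<alpha> \<gamma> * C \<gamma> \<delta>)"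
    by (intro mmul_eq_sum E) (auto simp: AB intro!: sum.neutral)
  also have "\<dots> = (\<Sum>\<beta>\<in>?F. \<Sum>\<gamma>\<in>?E. A \<alpha> \<beta> * B \<beta> \<gamma> * C \<gamma> \<delta>)"
    unfolding AB sum_distrib_right by (rule sum.swap)
  also have "\<dots> = (A \<odot> (B \<odot> C)) \<alpha> \<delta>"
    unfolding mmul_row_sum[OF assms(1), of "B \<odot> C"]
    by (intro sum.cong refl) (simp add: BC sum_distrib_left mult.assoc)
  finally show "((A \<odot> B) \<odot> C) \<alpha> \<delta> = (A \<odot> (B \<odot> C)) \<alpha> \<delta>" .
qed

lemma mmul_mone_left [simp]: "mone \<odot> A = A"
proof (intro ext)
  show "(mone \<odot> A) \<alpha> \<gamma> = A \<alpha> \<gamma>" for \<alpha> \<gamma>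
    using mmul_eq_sum[of "{\<alpha>}" mone \<alpha> A \<gamma>] by (auto simp: mone_def)
qed

lemma mmul_mone_right [simp]: "A \<odot> mone = A"
proof (intro ext)
  show "(A \<odot> mone) \<alpha> \<gamma> = A \<alpha> \<gamma>" for \<alpha> \<gamma>
    using mmul_eq_sum[of "{\<gamma>}" A \<alpha> mone \<gamma>] by (auto simp: mone_def)
qed

lemma mmul_add_left:
  assumes "row_finite A" "row_finite B"
  shows "((\<lambda>\<alpha> \<beta>. A \<alpha> \<beta> + B \<alpha> \<beta>) \<odot> C) = (\<lambda>\<alpha> \<beta>. (A \<odot> C) \<alpha> \<beta> + (B \<odot> C) \<alpha> \<beta>)"
proof (intro ext)
  fix \<alpha> \<gamma>
  let ?F = "{\<beta>. A \<alpha> \<beta> \<noteq> 0} \<union> {\<beta>. B \<alpha> \<beta> \<noteq> 0}"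
  have F: "finite ?F"
    using assms by (auto simp: row_finite_def)
  have "(A \<odot> C) \<alpha> \<gamma> = (\<Sum>\<beta>\<in>?F. A \<alpha> \<beta> * C \<beta> \<gamma>)" "(B \<odot> C) \<alpha> \<gamma> = (\<Sum>\<beta>\<in>?F. B \<alpha> \<beta> * C \<beta> \<gamma>)"
    "((\<lambda>\<alpha> \<beta>. A \<alpha> \<beta> + B \<alpha> \<beta>) \<odot> C) \<alpha> \<gamma> = (\<Sum>\<beta>\<in>?F. (A \<alpha> \<beta> + B \<alpha> \<beta>) * C \<beta> \<gamma>)"
    by (intro mmul_eq_sum[OF F]; auto)+
  then show "((\<lambda>\<alpha> \<beta>. A \<alpha> \<beta> + B \<alpha> \<beta>) \<odot> C) \<alpha> \<gamma> = (A \<odot> C) \<alpha> \<gamma> + (B \<odot> C) \<alpha> \<gamma>"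
    by (simp add: algebra_simps sum.distrib)
qed

section \<open>Block triangular matrices and their inverses\<close>

lemma block_lower_unitriangular_row_finite:
  "block_lower_unitriangular S \<Longrightarrow> row_finite S"
  by (rule row_finiteI_mdeg[where f = mdeg]) (auto simp: block_lower_unitriangular_def mone_def)

lemma block_diagonal_row_finite: "block_diagonal H \<Longrightarrow> row_finite H"
  by (rule row_finiteI_mdeg[where f = mdeg]) (auto simp: block_diagonal_def)

lemma row_finite_blk: "row_finite (blk k l A)"
  by (rule row_finiteI_mdeg[where f = "\<lambda>_. l"]) (auto simp: blk_def level_def)

lemma block_lower_unitriangular_mone: "block_lower_unitriangular mone"
  by (simp add: block_lower_unitriangular_def)

text \<open>Separates the identity block on the diagonal from the strictly lower levels. This is the
  recursion of forward substitution, for an arbitrary right factor.\<close>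

lemma block_lower_unitriangular_mmul_eq:
  assumes "block_lower_unitriangular S"
  shows "(S \<odot> A) \<alpha> \<gamma> = A \<alpha> \<gamma> + (\<Sum>\<beta> | mdeg \<beta> < mdeg \<alpha>. S \<alpha> \<beta> * A \<beta> \<gamma>)"
proof -
  have fin: "finite {\<beta> :: nat ^ 'a. mdeg \<beta> < mdeg \<alpha>}"
    by (rule finite_subset[OF _ finite_mdeg_le[of "mdeg \<alpha>"]]) auto
  have S: "S \<alpha> \<beta> = mone \<alpha> \<beta>" if "mdeg \<alpha> \<le> mdeg \<beta>" for \<beta>
    using assms that by (simp add: block_lower_unitriangular_def)
  have "(S \<odot> A) \<alpha> \<gamma> = (\<Sum>\<beta>\<in>insert \<alpha> {\<beta>. mdeg \<beta> < mdeg \<alpha>}. S \<alpha> \<beta> * A \<beta> \<gamma>)"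
  proof (intro mmul_eq_sum)
    show "finite (insert \<alpha> {\<beta> :: nat ^ 'a. mdeg \<beta> < mdeg \<alpha>})"
      using fin by simp
    show "S \<alpha> \<beta> * A \<beta> \<gamma> = 0" if "\<beta> \<notin> insert \<alpha> {\<beta>. mdeg \<beta> < mdeg \<alpha>}" for \<beta>
      using that S[of \<beta>] by (auto simp: mone_def)
  qed
  then show ?thesis
    using fin S[of \<alpha>] by (simp add: mone_def)
qed

lemma block_lower_unitriangular_mmul:
  assumes "block_lower_unitriangular S" "block_lower_unitriangular L"
  shows "block_lower_unitriangular (S \<odot> L)"
  unfolding block_lower_unitriangular_def
proof (intro allI impI)
  fix \<alpha> \<gamma> :: "nat ^ 'a"
  assume le: "mdeg \<alpha> \<le> mdeg \<gamma>"
  have L: "L \<beta> \<gamma> = mone \<beta> \<gamma>" if "mdeg \<beta> \<le> mdeg \<gamma>" for \<beta>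
    using assms(2) that by (simp add: block_lower_unitriangular_def)
  have "(\<Sum>\<beta> | mdeg \<beta> < mdeg \<alpha>. S \<alpha> \<beta> * L \<beta> \<gamma>) = 0"
    using le by (intro sum.neutral) (auto simp: L mone_def)
  then show "(S \<odot> L) \<alpha> \<gamma> = mone \<alpha> \<gamma>"
    by (simp add: block_lower_unitriangular_mmul_eq[OF assms(1)] L[OF le])
qed

text \<open>Forward substitution: the equation \<open>S \<odot> L = mone\<close> expresses each row
  of \<open>L\<close> through rows of smaller degree, so \<open>L\<close> is obtained by
  well-founded recursion on the degree of the row index.\<close>

lemma block_lower_unitriangular_right_inverse:
  assumes S: "block_lower_unitriangular S"
  shows "\<exists>L. block_lower_unitriangular L \<and> S \<odot> L = mone"
proof -
  define step where "step L \<alpha> \<gamma> = mone \<alpha> \<gamma> - (\<Sum>\<beta> | mdeg \<beta> < mdeg \<alpha>. S \<alpha> \<beta> * L \<beta> \<gamma>)"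
    for L :: "'a smat" and \<alpha> \<gamma>
  define L where "L = wfrec (inv_image less_than mdeg) step"
  have "adm_wf (inv_image less_than mdeg) step"
    unfolding adm_wf_def step_def by (auto intro!: ext sum.cong)
  then have L: "L \<alpha> = step L \<alpha>" for \<alpha>
    unfolding L_def by (intro wfrec_fixpoint[THEN fun_cong]) auto
  have "S \<odot> L = mone"
  proof (intro ext)
    show "(S \<odot> L) \<alpha> \<gamma> = mone \<alpha> \<gamma>" for \<alpha> \<gamma>
      by (simp add: block_lower_unitriangular_mmul_eq[OF S] L[of \<alpha>] step_def)
  qed
  moreover have "L \<alpha> \<gamma> = mone \<alpha> \<gamma>" if "mdeg \<alpha> \<le> mdeg \<gamma>" for \<alpha> \<gamma>
    using that
  proof (induction "mdeg \<alpha>" arbitrary: \<alpha> rule: less_induct)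
    case less
    have "L \<beta> \<gamma> = 0" if "mdeg \<beta> < mdeg \<alpha>" for \<beta>
      using less.hyps[OF that] less.prems that by (auto simp: mone_def)
    then show ?case
      by (simp add: L[of \<alpha>] step_def)
  qed
  ultimately show ?thesis
    by (auto simp: block_lower_unitriangular_def)
qed

text \<open>Justifies the definite description in \<open>lower_inv\<close>. The right inverse
  \<open>L\<close> has a right inverse \<open>R\<close> of its own, and
  \<open>S = S (L R) = (S L) R = R\<close> makes \<open>L\<close> two-sided.\<close>

lemma lower_inv:
  assumes S: "block_lower_unitriangular S"
  shows "block_lower_unitriangular (lower_inv S)" "S \<odot> lower_inv S = mone" "lower_inv S \<odot> S = mone"
proof -
  obtain L where L: "block_lower_unitriangular L" "S \<odot> L = mone"
    using block_lower_unitriangular_right_inverse[OF S] by blast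
  obtain R where R: "L \<odot> R = mone"
    using block_lower_unitriangular_right_inverse[OF L(1)] by blast
  note fin = block_lower_unitriangular_row_finite
  have "S = R"
    using mmul_assoc[OF fin[OF S] fin[OF L(1)], of R] by (simp add: L R)
  then have LS: "L \<odot> S = mone"
    using R by simp
  have "block_lower_unitriangular (lower_inv S) \<and> S \<odot> lower_inv S = mone \<and> lower_inv S \<odot> S = mone"
    unfolding lower_inv_def
  proof (rule theI[of _ L])
    show "block_lower_unitriangular L \<and> S \<odot> L = mone \<and> L \<odot> S = mone"
      using L LS by simp
    show "L' = L" if "block_lower_unitriangular L' \<and> S \<odot> L' = mone \<and> L' \<odot> S = mone" for L'
      using that mmul_assoc[OF fin[OF L(1)] fin[OF S], of L'] LS by simp
  qed
  then show "block_lower_unitriangular (lower_inv S)" "S \<odot> lower_inv S = mone" "lower_inv S \<odot> S = mone"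
    by simp_all
qed

text \<open>The usual argument in a monoid, with the padded identity block as unit; the condition
  \<open>blk k k B = B\<close> supplies the support on which that unit is neutral.\<close>

lemma is_blk_inv_unique:
  assumes "is_blk_inv k A B" "is_blk_inv k A B'"
  shows "B = B'"
proof -
  have blk_one: "blk k k mone \<odot> X = X" "X \<odot> blk k k mone = X" if "blk k k X = X" for X :: "'a smat"
  proof -
    have X: "X \<alpha> \<beta> = 0" if "\<alpha> \<notin> level k \<or> \<beta> \<notin> level k" for \<alpha> \<beta>
      using that fun_cong[OF fun_cong[OF \<open>blk k k X = X\<close>], of \<alpha> \<beta>] by (auto simp: blk_def)
    show "blk k k mone \<odot> X = X"
    proof (intro ext)
      show "(blk k k mone \<odot> X) \<alpha> \<gamma> = X \<alpha> \<gamma>" for \<alpha> \<gamma>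
        using mmul_eq_sum[of "{\<alpha>}" "blk k k mone" \<alpha> X \<gamma>] X by (auto simp: mone_def blk_def)
    qed
    show "X \<odot> blk k k mone = X"
    proof (intro ext)
      show "(X \<odot> blk k k mone) \<alpha> \<gamma> = X \<alpha> \<gamma>" for \<alpha> \<gamma>
        using mmul_eq_sum[of "{\<gamma>}" X \<alpha> "blk k k mone" \<gamma>] X by (auto simp: mone_def blk_def)
    qed
  qed
  have "row_finite B"
    using assms(1) row_finite_blk[of k k B] by (simp add: is_blk_inv_def)
  then have "B \<odot> blk k k A \<odot> B' = B \<odot> (blk k k A \<odot> B')"
    by (intro mmul_assoc row_finite_blk)
  then show ?thesis
    using assms blk_one by (simp add: is_blk_inv_def)
qed

lemma is_blk_inv_blk_inv:
  assumes "is_blk_inv k A B"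
  shows "is_blk_inv k A (blk_inv k A)"
  unfolding blk_inv_def using assms is_blk_inv_unique[OF _ assms] by (rule theI)

text \<open>Reconciles \<open>rho\<close>, which inverts an already extracted block, with the
  connection formula, which inverts a block of the whole \<open>H\<close>.\<close>

lemma blk_inv_blk: "blk_inv k (blk k k A) = blk_inv k A"
proof -
  have "blk k k (blk k k A) = blk k k A"
    by (auto simp: blk_def fun_eq_iff)
  then show ?thesis
    by (simp add: blk_inv_def is_blk_inv_def)
qed

lemma blk_inv_eq_0:
  assumes "\<exists>B. is_blk_inv k A B" "\<beta> \<notin> level k"
  shows "blk_inv k A \<alpha> \<beta> = 0"
proof -
  have "blk k k (blk_inv k A) = blk_inv k A"
    using assms(1) is_blk_inv_blk_inv by (auto simp: is_blk_inv_def)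
  then show ?thesis
    using assms(2) by (metis (no_types, lifting) blk_def)
qed

subsection \<open>The connection formula\<close>

lemma mtrans_mmul: "mtrans (A \<odot> B) = mtrans B \<odot> mtrans A"
  by (simp add: mtrans_def mmul_def mult.commute)

lemma mmul_row_cong: "(\<And>\<beta>. A \<alpha> \<beta> = A' \<alpha> \<beta>) \<Longrightarrow> (A \<odot> B) \<alpha> \<gamma> = (A' \<odot> B) \<alpha> \<gamma>"
  by (simp add: mmul_def)

lemma mdeg_add_axis [simp]: "mdeg (\<beta> + axis a (1 :: nat)) = Suc (mdeg \<beta>)"
proof -
  have "(\<Sum>b\<in>UNIV. axis a (1 :: nat) $ b) = 1"
    by (subst sum.remove[of _ a]) (auto simp: axis_def intro!: sum.neutral)
  then show ?thesis
    by (simp add: mdeg_def sum.distrib)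
qed

lemmas mdeg_add_axis_Suc_0 [simp] = mdeg_add_axis[unfolded One_nat_def]

lemma mdeg_eq_0_iff: "mdeg \<alpha> = 0 \<longleftrightarrow> \<alpha> = 0"
  by (auto simp: mdeg_def vec_eq_iff)

text \<open>Replaces the coefficient matrix of the second kind functions by \<open>S G\<close>, so
  that they can be computed from moments.\<close>

lemma block_factorization_mmul_eq:
  assumes "block_factorization G S H"
  shows "S \<odot> G = H \<odot> mtrans (lower_inv S)"
proof -
  have S: "block_lower_unitriangular S" and H: "block_diagonal H"
    and G: "G = lower_inv S \<odot> H \<odot> mtrans (lower_inv S)"
    using assms by (simp_all add: block_factorization_def)
  note fin = block_lower_unitriangular_row_finite[OF S]
    block_lower_unitriangular_row_finite[OF lower_inv(1)[OF S]] block_diagonal_row_finite[OF H]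
  have "S \<odot> G = S \<odot> (lower_inv S \<odot> H) \<odot> mtrans (lower_inv S)"
    unfolding G by (intro mmul_assoc[symmetric] fin row_finite_mmul)
  also have "S \<odot> (lower_inv S \<odot> H) = S \<odot> lower_inv S \<odot> H"
    by (intro mmul_assoc[symmetric] fin)
  finally show ?thesis
    by (simp add: lower_inv(2)[OF S])
qed

text \<open>This is orthogonality: the transpose of \<open>lower_inv S\<close> is block upper
  unitriangular, so on and below the block diagonal only \<open>H\<close> survives.\<close>

lemma block_factorization_mmul_lower:
  assumes "block_factorization G S H" "mdeg \<beta> \<le> mdeg \<alpha>"
  shows "(S \<odot> G) \<alpha> \<beta> = H \<alpha> \<beta>"
proof -
  have S: "block_lower_unitriangular S" and H: "block_diagonal H"
    using assms(1) by (simp_all add: block_factorization_def)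
  have L: "H \<alpha> \<gamma> * mtrans (lower_inv S) \<gamma> \<beta> = H \<alpha> \<gamma> * mone \<gamma> \<beta>" for \<gamma>
  proof (cases "mdeg \<gamma> = mdeg \<alpha>")
    case True
    then have "lower_inv S \<beta> \<gamma> = mone \<beta> \<gamma>"
      using assms(2) lower_inv(1)[OF S] by (simp add: block_lower_unitriangular_def)
    then show ?thesis
      by (simp add: mtrans_def mone_def)
  next
    case False
    then show ?thesis
      using H by (simp add: block_diagonal_def)
  qed
  have "(H \<odot> mtrans (lower_inv S)) \<alpha> \<beta> = (H \<odot> mone) \<alpha> \<beta>"
    unfolding mmul_def by (simp only: L)
  then show ?thesis
    by (simp add: block_factorization_mmul_eq[OF assms(1)])
qed

text \<open>Column \<gamma> of the transposed shift has at most one nonzero entry, in row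
  \<open>\<gamma> + axis a 1\<close>.\<close>

lemma blk_mmul_mtrans_Lam:
  assumes "\<alpha> \<in> level k"
  shows "(blk k k H \<odot> mtrans (blk (k - 1) k (Lam a))) \<alpha> \<gamma> =
    (if \<gamma> \<in> level (k - 1) \<and> \<gamma> + axis a 1 \<in> level k then H \<alpha> (\<gamma> + axis a 1) else 0)"
  using assms mmul_eq_sum[of "{\<gamma> + axis a 1}" "blk k k H" \<alpha> "mtrans (blk (k - 1) k (Lam a))" \<gamma>]
  by (auto simp: blk_def mtrans_def Lam_def)

text \<open>
  The matrix \<open>S (S')\<^sup>-\<^sup>1\<close> is determined by \<open>S G' = (S (S')\<^sup>-\<^sup>1) H' ((S')\<^sup>-\<^sup>1)\<^sup>\<top>\<close>: as \<open>S G\<close> is block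
  upper triangular and \<open>G'\<close> is \<open>G\<close> up to a shift of the columns by one level, it has only one
  nonzero block diagonal below the main one.
\<close>

lemma block_factorization_shift:
  fixes G :: "('d::finite) smat"
  assumes fact: "block_factorization G S H" and fact': "block_factorization G' S' H'"
    and G': "\<And>\<alpha> \<beta>. G' \<alpha> \<beta> = G \<alpha> (\<beta> + axis a 1) - c * G \<alpha> \<beta>"
    and \<alpha>: "\<alpha> \<in> level k" and "k > 0"
  shows "(S \<odot> A) \<alpha> \<gamma> = (S' \<odot> A) \<alpha> \<gamma> +
    (blk k k H \<odot> mtrans (blk (k - 1) k (Lam a)) \<odot> blk_inv (k - 1) H' \<odot> (S' \<odot> A)) \<alpha> \<gamma>"
proof -
  let ?L = "lower_inv S'"
  \<comment> \<open>\<open>K\<close> is the connection matrix; \<open>W\<close> is computed first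
    because \<open>S G'\<close> determines it directly, and \<open>R\<close> is the expected part of
    row \<alpha> of \<open>K\<close> below the diagonal.\<close>
  define K where "K = S \<odot> ?L"
  define W where "W = K \<odot> H'"
  define R where "R = blk k k H \<odot> mtrans (blk (k - 1) k (Lam a)) \<odot> blk_inv (k - 1) H'"
  have S: "block_lower_unitriangular S" and S': "block_lower_unitriangular S'"
    and H: "block_diagonal H" and H': "block_diagonal H'"
    and G'_eq: "G' = ?L \<odot> H' \<odot> mtrans ?L"
    using fact fact' by (auto simp: block_factorization_def)
  have inv: "is_blk_inv l H' (blk_inv l H')" for l
    using fact' is_blk_inv_blk_inv unfolding block_factorization_def by metis
  note L = lower_inv[OF S']
  note rf = block_lower_unitriangular_row_finite[OF S] block_lower_unitriangular_row_finite[OF S']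
    block_lower_unitriangular_row_finite[OF L(1)] block_diagonal_row_finite[OF H']
  have K: "block_lower_unitriangular K"
    unfolding K_def by (intro block_lower_unitriangular_mmul S L)
  note rfK = block_lower_unitriangular_row_finite[OF K]
  have k: "mdeg \<alpha> = k"
    using \<alpha> by (simp add: level_def)
  have WL_eq: "W \<odot> mtrans ?L = S \<odot> G'"
    unfolding W_def K_def G'_eq by (simp add: mmul_assoc rf row_finite_mmul)
  have SG': "(S \<odot> G') \<alpha> \<beta> = (S \<odot> G) \<alpha> (\<beta> + axis a 1) - c * (S \<odot> G) \<alpha> \<beta>" for \<beta>
    by (simp add: mmul_row_sum[OF rf(1)] G' algebra_simps sum_subtractf sum_distrib_left)
  \<comment> \<open>Transposition turns the upper triangular right factor into a lower triangular
    left factor.\<close>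
  have WL: "(W \<odot> mtrans ?L) \<alpha> \<beta> = W \<alpha> \<beta> + (\<Sum>\<gamma> | mdeg \<gamma> < mdeg \<beta>. ?L \<beta> \<gamma> * W \<alpha> \<gamma>)" for \<beta>
    using block_lower_unitriangular_mmul_eq[OF L(1), of "mtrans W" \<beta> \<alpha>]
      fun_cong[OF fun_cong[OF mtrans_mmul[of W "mtrans ?L"]], of \<beta> \<alpha>]
    by (simp add: mtrans_def)
  \<comment> \<open>Below level \<open>k\<close>, row \<alpha> of \<open>S G\<close> vanishes, which
    removes the term with \<open>c\<close>. The shifted column has level at most \<open>k\<close>
    and contributes an entry of \<open>H\<close>.\<close>
  have W_rec: "W \<alpha> \<beta> = H \<alpha> (\<beta> + axis a 1) - (\<Sum>\<gamma> | mdeg \<gamma> < mdeg \<beta>. ?L \<beta> \<gamma> * W \<alpha> \<gamma>)"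
    if "mdeg \<beta> < k" for \<beta>
  proof -
    have "(S \<odot> G) \<alpha> (\<beta> + axis a 1) = H \<alpha> (\<beta> + axis a 1)"
      using that k by (intro block_factorization_mmul_lower[OF fact]) (simp add: mdeg_add_axis)
    moreover have "(S \<odot> G) \<alpha> \<beta> = 0"
      using block_factorization_mmul_lower[OF fact, of \<beta> \<alpha>] that k H by (simp add: block_diagonal_def)
    ultimately show ?thesis
      using SG'[of \<beta>] WL[of \<beta>] by (simp add: WL_eq)
  qed
  \<comment> \<open>The correction sum is zero: if \<gamma> has smaller degree than \<beta>, then
    \<open>\<gamma> + axis a 1\<close> is still below level \<open>k\<close>, where row \<alpha> of
    \<open>H\<close> vanishes.\<close>
  have W: "W \<alpha> \<beta> = H \<alpha> (\<beta> + axis a 1)" if "mdeg \<beta> < k" for \<beta>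
    using that
  proof (induction "mdeg \<beta>" arbitrary: \<beta> rule: less_induct)
    case less
    have "W \<alpha> \<gamma> = 0" if "mdeg \<gamma> < mdeg \<beta>" for \<gamma>
      using less.hyps[OF that] less.prems that H k by (simp add: block_diagonal_def)
    then show ?case
      by (simp add: W_rec[OF less.prems])
  qed
  have KH: "(K \<odot> blk l l H') \<alpha> \<gamma> = (if \<gamma> \<in> level l then H \<alpha> (\<gamma> + axis a 1) else 0)"
    if "l < k" for l \<gamma>
  proof (cases "\<gamma> \<in> level l")
    case True
    then have "blk l l H' \<beta> \<gamma> = H' \<beta> \<gamma>" for \<beta>
      using H' by (auto simp: blk_def level_def block_diagonal_def)
    then have "(K \<odot> blk l l H') \<alpha> \<gamma> = W \<alpha> \<gamma>"
      by (simp add: W_def mmul_def)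
    then show ?thesis
      using True that by (simp add: W level_def)
  next
    case False
    then show ?thesis
      by (simp add: mmul_def blk_def)
  qed
  \<comment> \<open>Column block \<open>l\<close> of \<open>K\<close> is recovered from
    \<open>K H'\<close> by cancelling the invertible diagonal block of \<open>H'\<close>.\<close>
  have K_blk: "K \<alpha> \<beta> = (K \<odot> blk l l H' \<odot> blk_inv l H') \<alpha> \<beta>" if "mdeg \<beta> = l" for l \<beta>
  proof -
    have "(K \<odot> blk l l mone) \<alpha> \<beta> = K \<alpha> \<beta>"
      using that mmul_eq_sum[of "{\<beta>}" K \<alpha> "blk l l mone" \<beta>] by (auto simp: blk_def mone_def level_def)
    then show ?thesis
      using inv[of l] by (simp add: is_blk_inv_def mmul_assoc rfK row_finite_blk)
  qed
  have R_0: "R \<alpha> \<beta> = 0" if "\<beta> \<notin> level (k - 1)" for \<beta>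
  proof -
    have "blk_inv (k - 1) H' \<gamma> \<beta> = 0" for \<gamma>
      using inv that by (blast intro: blk_inv_eq_0)
    then show ?thesis
      by (simp add: R_def mmul_def)
  qed
  \<comment> \<open>Among the levels below \<open>k\<close>, only \<open>k - 1\<close> is carried to
    level \<open>k\<close> by the shift, so only there does \<open>K\<close> have a nonzero block
    below the diagonal.\<close>
  have K_eq: "K \<alpha> \<beta> = mone \<alpha> \<beta> + R \<alpha> \<beta>" for \<beta>
  proof -
    consider "k \<le> mdeg \<beta>" | "mdeg \<beta> = k - 1" | "mdeg \<beta> < k - 1"
      by linarith
    then show ?thesis
    proof cases
      case 2
      have "R \<alpha> \<beta> = (K \<odot> blk (k - 1) (k - 1) H' \<odot> blk_inv (k - 1) H') \<alpha> \<beta>"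
        unfolding R_def
        by (rule mmul_row_cong, unfold blk_mmul_mtrans_Lam[OF \<alpha>], subst KH)
          (use \<open>k > 0\<close> in \<open>auto simp: level_def\<close>)
      then show ?thesis
        using 2 \<open>k > 0\<close> k K_blk[OF 2] by (auto simp: mone_def)
    next
      case 1
      then have "\<beta> \<notin> level (k - 1)"
        using \<open>k > 0\<close> by (auto simp: level_def)
      then have "R \<alpha> \<beta> = 0"
        by (rule R_0)
      then show ?thesis
        using 1 K k by (simp add: block_lower_unitriangular_def)
    next
      case 3
      then have "\<beta> \<notin> level (k - 1)"
        by (auto simp: level_def)
      then have "R \<alpha> \<beta> = 0"
        by (rule R_0)
      moreover have "(K \<odot> blk (mdeg \<beta>) (mdeg \<beta>) H') \<alpha> \<gamma> = 0" for \<gamma>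
        using 3 k H by (subst KH) (auto simp: level_def block_diagonal_def)
      then have "K \<alpha> \<beta> = 0"
        unfolding K_blk[OF refl] by (simp add: mmul_def)
      ultimately show ?thesis
        using 3 k by (auto simp: mone_def)
    qed
  qed
  have "row_finite (blk_inv (k - 1) H')"
    using inv[of "k - 1"] row_finite_blk[of "k - 1" "k - 1" "blk_inv (k - 1) H'"]
    by (simp add: is_blk_inv_def)
  moreover have "row_finite (mtrans (blk (k - 1) k (Lam a)))"
    by (rule row_finiteI_mdeg[where f = "\<lambda>_. k - 1"]) (auto simp: blk_def level_def mtrans_def)
  ultimately have R: "row_finite R"
    unfolding R_def by (intro row_finite_mmul row_finite_blk)
  have "S \<odot> A = K \<odot> (S' \<odot> A)"
  proof -
    have "S = K \<odot> S'"
      by (simp add: K_def mmul_assoc rf L)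
    then show ?thesis
      by (metis mmul_assoc rfK rf(2))
  qed
  \<comment> \<open>\<open>K_eq\<close> is known for row \<alpha> alone; this suffices, since an
    entry of a product sees one row of the left factor.\<close>
  then have "(S \<odot> A) \<alpha> \<gamma> = ((\<lambda>\<alpha> \<beta>. mone \<alpha> \<beta> + R \<alpha> \<beta>) \<odot> (S' \<odot> A)) \<alpha> \<gamma>"
    by (simp only:) (rule mmul_row_cong, rule K_eq)
  also have "\<dots> = (S' \<odot> A) \<alpha> \<gamma> + (R \<odot> (S' \<odot> A)) \<alpha> \<gamma>"
    by (subst mmul_add_left)
      (auto simp: R block_lower_unitriangular_row_finite block_lower_unitriangular_mone)
  finally show ?thesis
    by (simp add: R_def)
qed

subsection \<open>Moments of the shifted measures\<close>

text \<open>The complement of the support is the union of all open null sets, and the support lies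
  in a box. Compactness keeps it at a positive distance from the hyperplanes where some factor of
  the weight vanishes.\<close>

lemma compact_msupp:
  assumes "msupp M \<subseteq> {x. \<forall>a. \<bar>x $ a\<bar> < \<bar>q $ a\<bar>}"
  shows "compact (msupp M)"
proof -
  have "- msupp M = \<Union>{U. open U \<and> emeasure M U = 0}"
    by (auto simp: msupp_def zero_less_iff_neq_zero)
  then have "closed (msupp M)"
    unfolding closed_def by auto
  moreover have "bounded (msupp M)"
  proof (rule boundedI)
    show "norm x \<le> (\<Sum>a\<in>UNIV. \<bar>q $ a\<bar>)" if "x \<in> msupp M" for x
      using that assms by (intro order_trans[OF norm_le_l1_cart] sum_mono) (auto intro: less_imp_le)
  qed
  ultimately show ?thesis
    by (simp add: compact_eq_bounded_closed)
qed

text \<open>By Lindelof, countably many open null sets already cover the complement of the support,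
  so that complement is a null set.\<close>

lemma AE_msupp:
  assumes "sets M = sets borel"
  shows "AE x in M. x \<in> msupp M"
proof -
  obtain \<U> where \<U>: "\<U> \<subseteq> {U. open U \<and> emeasure M U = 0}" "countable \<U>"
    "\<Union>\<U> = \<Union>{U. open U \<and> emeasure M U = 0}"
    using Lindelof[of "{U. open U \<and> emeasure M U = 0}"] by auto
  have "- msupp M = \<Union>\<U>"
    unfolding \<U>(3) by (auto simp: msupp_def zero_less_iff_neq_zero)
  moreover have "\<Union>\<U> \<in> null_sets M"
  proof (rule null_sets_UN'[of \<U> "\<lambda>U. U", simplified])
    show "U \<in> null_sets M" if "U \<in> \<U>" for U
      using that \<U>(1) assms by (auto simp: null_sets_def)
  qed (use \<U> in auto)
  ultimately have "- msupp M \<in> null_sets M"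
    by simp
  then show ?thesis
    by (rule AE_I') auto
qed

lemma msupp_neq:
  assumes "msupp M \<subseteq> {x. \<forall>a. \<bar>x $ a\<bar> < \<bar>q $ a\<bar>}" "x \<in> msupp M"
  shows "x $ a \<noteq> q $ a"
proof -
  have "\<bar>x $ a\<bar> < \<bar>q $ a\<bar>"
    using assms by blast
  then show ?thesis
    by auto
qed

section \<open>Geometric series in several variables and their termwise integration\<close>

lemma has_sum_chi:
  fixes y :: "real ^ 'd::finite"
  assumes "\<And>a. \<bar>y $ a\<bar> < 1"
  shows "(chi y has_sum (\<Prod>a\<in>UNIV. 1 / (1 - y $ a))) UNIV"
proof -
  let ?f = "\<lambda>a n. (y $ a) ^ n"
  let ?F = "\<lambda>g. \<Prod>a\<in>UNIV. ?f a (g a)"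
  have abs: "(\<lambda>n. norm (?f a n)) summable_on UNIV" for a
    using assms[of a] by (intro norm_summable_imp_summable_on) (simp add: power_abs summable_geometric)
  have inf: "infsum (?f a) UNIV = 1 / (1 - y $ a)" for a
    using has_sum_imp_sums[OF has_sum_infsum[OF abs_summable_summable[OF abs]]]
      geometric_sums[of "y $ a"] assms[of a] by (metis real_norm_def sums_unique2)
  \<comment> \<open>Absolute convergence lets the product of the geometric series be expanded into a
    sum over exponent functions; these are identified with vectors at the end.\<close>
  have "Infinite_Set_Sum.abs_summable_on ?F (PiE UNIV (\<lambda>_. UNIV))"
    using abs_summable_equivalent[THEN iffD1, OF abs]
    by (intro abs_summable_on_prod_PiE[where f = ?f]) simp_all
  then have "?F summable_on PiE UNIV (\<lambda>_. UNIV)"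
    by (rule abs_summable_summable[OF abs_summable_equivalent[THEN iffD2]])
  moreover have "infsum ?F (PiE UNIV (\<lambda>_. UNIV)) = (\<Prod>a\<in>UNIV. 1 / (1 - y $ a))"
    unfolding infsum_prod_PiE_abs[of UNIV ?f "\<lambda>_. UNIV", OF finite_class.finite_UNIV abs] inf ..
  ultimately have "(?F has_sum (\<Prod>a\<in>UNIV. 1 / (1 - y $ a))) UNIV"
    by (simp add: has_sum_iff)
  moreover have "bij_betw vec_nth UNIV (UNIV :: ('d \<Rightarrow> nat) set)"
    by (rule bij_betw_byWitness[where f' = vec_lambda]) auto
  ultimately show ?thesis
    unfolding chi_def[abs_def]
    using has_sum_reindex_bij_betw[of vec_nth UNIV UNIV ?F] by simp
qed

lemma chi_measurable [measurable]: "(\<lambda>x. chi x \<beta>) \<in> borel_measurable borel"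
  unfolding chi_def by measurable

text \<open>The geometric series converges uniformly on the support, so no limit theorem for integrals is needed.\<close>

lemma has_sum_integral_chi:
  fixes f :: "real ^ 'd::finite \<Rightarrow> real"
  assumes M: "finite_measure M" "sets M = sets borel"
    and f: "f \<in> borel_measurable borel" "AE x in M. \<bar>f x\<bar> \<le> C"
    and r: "\<And>a. 0 \<le> r $ a" "\<And>a. r $ a < 1" "AE x in M. \<forall>a. \<bar>x $ a / q $ a\<bar> \<le> r $ a"
  shows "((\<lambda>\<beta>. LINT x|M. f x * chi (\<chi> a. x $ a / q $ a) \<beta>) has_sum
    (LINT x|M. f x * (\<Prod>a\<in>UNIV. 1 / (1 - x $ a / q $ a)))) UNIV"
proof -
  interpret finite_measure M by fact
  let ?y = "\<lambda>x. \<chi> a. x $ a / q $ a"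
  let ?P = "\<lambda>y :: real ^ 'd. \<Prod>a\<in>UNIV. 1 / (1 - y $ a)"
  note [measurable_cong] = M(2)
  note [measurable] = f(1)
  have chi_le: "\<bar>chi (?y x) \<beta>\<bar> \<le> chi r \<beta>" if "\<forall>a. \<bar>x $ a / q $ a\<bar> \<le> r $ a" for x \<beta>
    unfolding chi_def abs_prod using that by (intro prod_mono) (auto simp: power_abs intro: power_mono)
  have P_meas [measurable]: "(\<lambda>x. ?P (?y x)) \<in> borel_measurable M"
    unfolding vec_lambda_beta by measurable
  have chi_meas [measurable]: "(\<lambda>x. chi (?y x) \<beta>) \<in> borel_measurable M" for \<beta>
    unfolding chi_def vec_lambda_beta by measurable
  \<comment> \<open>The remainder is the sum over the complement of \<open>F\<close>, dominated
    termwise by the series at \<open>r\<close>; the bound no longer depends on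
    \<open>x\<close>.\<close>
  have tail: "\<bar>?P (?y x) - (\<Sum>\<beta>\<in>F. chi (?y x) \<beta>)\<bar> \<le> ?P r - (\<Sum>\<beta>\<in>F. chi r \<beta>)"
    if "\<forall>a. \<bar>x $ a / q $ a\<bar> \<le> r $ a" "finite F" for x F
  proof -
    have "(chi (?y x) has_sum ?P (?y x)) UNIV" "(chi r has_sum ?P r) UNIV"
      using that r(1,2) has_sum_chi[of "?y x"] has_sum_chi[of r] by (auto intro: order.strict_trans1)
    then have diff: "(chi (?y x) has_sum (?P (?y x) - (\<Sum>\<beta>\<in>F. chi (?y x) \<beta>))) (UNIV - F)"
      "(chi r has_sum (?P r - (\<Sum>\<beta>\<in>F. chi r \<beta>))) (UNIV - F)"
      using \<open>finite F\<close> by (auto intro: has_sum_Diff)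
    then show ?thesis
      using norm_infsum_le[OF diff] chi_le[OF that(1)] by simp
  qed
  have bound: "AE x in M. \<bar>f x * (?P (?y x) - (\<Sum>\<beta>\<in>F. chi (?y x) \<beta>))\<bar> \<le> C * (?P r - (\<Sum>\<beta>\<in>F. chi r \<beta>))"
    if "finite F" for F
    using f(2) r(3)
  proof eventually_elim
    case (elim x)
    then show ?case
      using tail[OF elim(2) that] unfolding abs_mult by (intro mult_mono) auto
  qed
  have int_chi: "integrable M (\<lambda>x. f x * chi (?y x) \<beta>)" for \<beta>
  proof (rule integrable_const_bound)
    show "AE x in M. norm (f x * chi (?y x) \<beta>) \<le> C * chi r \<beta>"
      using f(2) r(3)
    proof eventually_elim
      case (elim x)
      then show ?case
        using chi_le[OF elim(2)] unfolding real_norm_def abs_mult by (intro mult_mono) auto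
    qed
  qed simp
  have int_P: "integrable M (\<lambda>x. f x * ?P (?y x))"
    by (rule integrable_const_bound[where B = "C * ?P r"]) (use bound[of "{}"] in simp_all)
  have "((\<lambda>F. (\<Sum>\<beta>\<in>F. LINT x|M. f x * chi (?y x) \<beta>) - (LINT x|M. f x * ?P (?y x))) \<longlongrightarrow> 0)
    (finite_subsets_at_top UNIV)"
  proof (rule Lim_null_comparison)
    show "\<forall>\<^sub>F F in finite_subsets_at_top UNIV.
      norm ((\<Sum>\<beta>\<in>F. LINT x|M. f x * chi (?y x) \<beta>) - (LINT x|M. f x * ?P (?y x)))
      \<le> C * (?P r - (\<Sum>\<beta>\<in>F. chi r \<beta>)) * measure M (space M)"
    proof (rule eventually_finite_subsets_at_top_weakI)
      fix F :: "(nat ^ 'd) set"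
      assume F: "finite F"
      let ?g = "\<lambda>x. f x * (?P (?y x) - (\<Sum>\<beta>\<in>F. chi (?y x) \<beta>))"
      have g: "?g = (\<lambda>x. f x * ?P (?y x) - (\<Sum>\<beta>\<in>F. f x * chi (?y x) \<beta>))"
        by (simp add: right_diff_distrib sum_distrib_left)
      have int_g: "integrable M ?g"
        unfolding g by (intro Bochner_Integration.integrable_diff int_P Bochner_Integration.integrable_sum int_chi)
      have "(LINT x|M. ?g x) = (LINT x|M. f x * ?P (?y x)) - (\<Sum>\<beta>\<in>F. LINT x|M. f x * chi (?y x) \<beta>)"
        unfolding g using int_P int_chi
        by (simp add: Bochner_Integration.integral_diff Bochner_Integration.integral_sum Bochner_Integration.integrable_sum)
      then have "norm ((\<Sum>\<beta>\<in>F. LINT x|M. f x * chi (?y x) \<beta>) - (LINT x|M. f x * ?P (?y x))) = norm (LINT x|M. ?g x)"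
        by (simp add: norm_minus_commute)
      also have "\<dots> \<le> (LINT x|M. norm (?g x))"
        by (rule integral_norm_bound)
      also have "\<dots> \<le> (LINT x|M. C * (?P r - (\<Sum>\<beta>\<in>F. chi r \<beta>)))"
        using bound[OF F] int_g by (intro integral_mono_AE) auto
      also have "\<dots> = C * (?P r - (\<Sum>\<beta>\<in>F. chi r \<beta>)) * measure M (space M)"
        by simp
      finally show "norm ((\<Sum>\<beta>\<in>F. LINT x|M. f x * chi (?y x) \<beta>) - (LINT x|M. f x * ?P (?y x)))
        \<le> C * (?P r - (\<Sum>\<beta>\<in>F. chi r \<beta>)) * measure M (space M)" .
    qed
    have "(sum (chi r) \<longlongrightarrow> ?P r) (finite_subsets_at_top UNIV)"
      using has_sum_chi[of r] r(1,2) by (simp add: has_sum_def)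
    then show "((\<lambda>F. C * (?P r - (\<Sum>\<beta>\<in>F. chi r \<beta>)) * measure M (space M)) \<longlongrightarrow> 0)
      (finite_subsets_at_top UNIV)"
      by (auto intro!: tendsto_eq_intros)
  qed
  then show ?thesis
    unfolding has_sum_def vec_lambda_beta by (rule LIM_zero_cancel)
qed

text \<open>Each coordinate ratio attains its maximum on the compact support, at a point
  \<open>z a\<close> that may vary with \<open>a\<close>, and the strict inequality there keeps the
  maximum below 1. For empty support, \<open>r = 0\<close> serves.\<close>

lemma msupp_ratio_bound:
  fixes q :: "real ^ 'd::finite"
  assumes "msupp M \<subseteq> {x. \<forall>a. \<bar>x $ a\<bar> < \<bar>q $ a\<bar>}"
  obtains r :: "real ^ 'd" where "\<And>a. 0 \<le> r $ a" "\<And>a. r $ a < 1"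
    "\<And>x a. x \<in> msupp M \<Longrightarrow> \<bar>x $ a / q $ a\<bar> \<le> r $ a"
proof (cases "msupp M = {}")
  case True
  then show ?thesis
    by (intro that[of 0]) auto
next
  case False
  have "\<exists>z\<in>msupp M. \<forall>x\<in>msupp M. \<bar>x $ a / q $ a\<bar> \<le> \<bar>z $ a / q $ a\<bar>" for a
    unfolding divide_inverse
    by (intro continuous_attains_sup compact_msupp[OF assms] False continuous_intros)
  then obtain z where z: "\<And>a. z a \<in> msupp M" "\<And>a x. x \<in> msupp M \<Longrightarrow> \<bar>x $ a / q $ a\<bar> \<le> \<bar>z a $ a / q $ a\<bar>"
    by metis
  have "\<bar>z a $ a / q $ a\<bar> < 1" for a
    using z(1)[of a] assms by (auto simp: abs_divide divide_less_eq_1 dest!: subsetD)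
  then show ?thesis
    using z by (intro that[of "\<chi> a. \<bar>z a $ a / q $ a\<bar>"]) auto
qed

section \<open>The weights and the relations between their moment matrices\<close>

definition weight :: "real ^ 'd \<Rightarrow> int ^ 'd \<Rightarrow> real ^ 'd \<Rightarrow> real"
  where "weight q m x = (\<Prod>a\<in>UNIV. (x $ a - q $ a) powi (m $ a))"

lemma weight_measurable [measurable]:
  fixes q :: "real ^ 'd::finite"
  shows "weight q m \<in> borel_measurable borel"
proof -
  have "(\<lambda>x :: real ^ 'd. (x $ a - q $ a) powi n) \<in> borel_measurable borel" for a n
    by (cases "n \<ge> 0") (simp_all add: power_int_def)
  then show ?thesis
    unfolding weight_def[abs_def] by measurable
qed

lemma moment_matrix_weight:
  "moment_matrix M q m = (\<lambda>\<alpha> \<beta>. LINT x|M. weight q m x * (chi x \<alpha> * chi x \<beta>))"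
  by (simp add: moment_matrix_def weight_def)

text \<open>The weight is continuous on the compact support even for negative exponents, since no
  coordinate of a support point equals that of \<open>q\<close>.\<close>

lemma weight_chi_bounded:
  fixes M :: "(real ^ 'd::finite) measure"
  assumes "sets M = sets borel" "msupp M \<subseteq> {x. \<forall>a. \<bar>x $ a\<bar> < \<bar>q $ a\<bar>}"
  obtains C where "AE x in M. \<bar>weight q m x * (chi x \<alpha> * chi x \<beta>)\<bar> \<le> C"
proof -
  have "compact ((\<lambda>x. weight q m x * (chi x \<alpha> * chi x \<beta>)) ` msupp M)"
    unfolding weight_def chi_def using assms(2)
    by (intro compact_continuous_image compact_msupp[OF assms(2)] continuous_intros)
      (auto simp: msupp_neq[OF assms(2)])
  then obtain C where "\<forall>x\<in>msupp M. \<bar>weight q m x * (chi x \<alpha> * chi x \<beta>)\<bar> \<le> C"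
    by (auto dest!: compact_imp_bounded simp: bounded_iff)
  then show ?thesis
    using AE_msupp[OF assms(1)] by (intro that[of C]) (auto elim: eventually_mono)
qed

lemma integrable_weight_chi:
  fixes M :: "(real ^ 'd::finite) measure"
  assumes "finite_measure M" "sets M = sets borel" "msupp M \<subseteq> {x. \<forall>a. \<bar>x $ a\<bar> < \<bar>q $ a\<bar>}"
  shows "integrable M (\<lambda>x. weight q m x * (chi x \<alpha> * chi x \<beta>))"
proof -
  note [measurable_cong] = assms(2)
  obtain C where "AE x in M. \<bar>weight q m x * (chi x \<alpha> * chi x \<beta>)\<bar> \<le> C"
    using weight_chi_bounded[OF assms(2,3)] by blast
  then show ?thesis
    by (intro finite_measure.integrable_const_bound[OF assms(1)]) simp_all
qed

lemma chi_zero [simp]: "chi x 0 = 1"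
  by (simp add: chi_def)

lemma chi_add_axis:
  fixes x :: "real ^ 'd::finite"
  shows "chi x (\<beta> + axis a 1) = x $ a * chi x \<beta>"
proof -
  have "chi x (\<beta> + axis a 1) = chi x \<beta> * (\<Prod>b\<in>UNIV. if b = a then x $ b else 1)"
    unfolding chi_def prod.distrib[symmetric]
    by (intro prod.cong) (auto simp: axis_def)
  then show ?thesis
    by simp
qed

text \<open>At \<open>x $ a = q $ a\<close> the passage from exponent -1 to 0 can fail because
  \<open>0 powi 0 = 1\<close>, whence the assumption.\<close>

lemma weight_add_axis:
  fixes x :: "real ^ 'd::finite"
  assumes "x $ a \<noteq> q $ a"
  shows "weight q (m + axis a 1) x = (x $ a - q $ a) * weight q m x"
proof -
  have "weight q (m + axis a 1) x = weight q m x * (\<Prod>b\<in>UNIV. if b = a then x $ b - q $ b else 1)"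
    unfolding weight_def prod.distrib[symmetric]
    using assms by (intro prod.cong) (auto simp: axis_def power_int_add)
  then show ?thesis
    by simp
qed

lemma sum_axis_nth: "(\<Sum>j\<in>J. axis j (1 :: int)) $ a = (if a \<in> J then 1 else 0)" for J :: "'d::finite set"
  by (simp add: axis_def if_distrib if_distribR cong: if_cong)

lemma weight_diff_all:
  fixes x :: "real ^ 'd::finite"
  assumes "\<And>a. x $ a \<noteq> q $ a"
  shows "weight q (m - (\<Sum>j\<in>UNIV. axis j 1)) x = weight q m x * (\<Prod>a\<in>UNIV. 1 / (x $ a - q $ a))"
  unfolding weight_def prod.distrib[symmetric]
  using assms by (intro prod.cong) (auto simp: sum_axis_nth power_int_diff simp del: sum_component)

text \<open>The extra factor \<open>x $ a - q $ a\<close> of the weight is absorbed into the column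
  monomial, almost everywhere.\<close>

lemma moment_matrix_add_axis:
  fixes M :: "(real ^ 'd::finite) measure"
  assumes M: "finite_measure M" "sets M = sets borel" and supp: "msupp M \<subseteq> {x. \<forall>a. \<bar>x $ a\<bar> < \<bar>q $ a\<bar>}"
  shows "moment_matrix M q (m + axis a 1) \<alpha> \<beta> =
    moment_matrix M q m \<alpha> (\<beta> + axis a 1) - q $ a * moment_matrix M q m \<alpha> \<beta>"
proof -
  note [measurable_cong] = assms(2)
  have "moment_matrix M q (m + axis a 1) \<alpha> \<beta> = (LINT x|M. weight q m x * (chi x \<alpha> * chi x (\<beta> + axis a 1)) -
    q $ a * (weight q m x * (chi x \<alpha> * chi x \<beta>)))"
    unfolding moment_matrix_weight
  proof (rule integral_cong_AE)
    show "AE x in M. weight q (m + axis a 1) x * (chi x \<alpha> * chi x \<beta>) =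
      weight q m x * (chi x \<alpha> * chi x (\<beta> + axis a 1)) - q $ a * (weight q m x * (chi x \<alpha> * chi x \<beta>))"
      using AE_msupp[OF M(2)]
    proof eventually_elim
      case (elim x)
      then have "x $ a \<noteq> q $ a"
        by (rule msupp_neq[OF supp])
      then show ?case
        by (simp add: weight_add_axis chi_add_axis[unfolded One_nat_def] algebra_simps)
    qed
  qed simp_all
  then show ?thesis
    unfolding moment_matrix_weight
    by (simp add: integrable_weight_chi[OF M supp] Bochner_Integration.integral_diff)
qed

text \<open>Pairing \<open>chi x\<close> with \<open>chi_star q\<close> gives the Cauchy kernel, the
  product of the factors \<open>1 / (q $ a - x $ a)\<close>. Each factor lowers one exponent of the
  weight by 1 and contributes one sign.\<close>

lemma has_sum_moment_matrix_chi_star: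
  fixes M :: "(real ^ 'd::finite) measure"
  assumes M: "finite_measure M" "sets M = sets borel" and supp: "msupp M \<subseteq> {x. \<forall>a. \<bar>x $ a\<bar> < \<bar>q $ a\<bar>}"
    and q: "\<And>a. q $ a \<noteq> 0"
  shows "((\<lambda>\<beta>. moment_matrix M q m \<alpha> \<beta> * chi_star q \<beta>) has_sum
    ((- 1) ^ CARD('d) * moment_matrix M q (m - (\<Sum>j\<in>UNIV. axis j 1)) \<alpha> 0)) UNIV"
proof -
  note [measurable_cong] = assms(2)
  let ?y = "\<lambda>x. \<chi> a. x $ a / q $ a"
  let ?c = "\<Prod>a\<in>UNIV. inverse (q $ a)"
  \<comment> \<open>The factor \<open>chi x 0\<close> equals 1; it gives the integrand the shape of
    an entry in column 0 of a moment matrix.\<close>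
  let ?f = "\<lambda>x. weight q m x * (chi x \<alpha> * chi x 0)"
  obtain r :: "real ^ 'd" where r: "\<And>a. 0 \<le> r $ a" "\<And>a. r $ a < 1"
    "\<And>x a. x \<in> msupp M \<Longrightarrow> \<bar>x $ a / q $ a\<bar> \<le> r $ a"
    using msupp_ratio_bound[OF supp] by blast
  obtain C where C: "AE x in M. \<bar>?f x\<bar> \<le> C"
    using weight_chi_bounded[OF M(2) supp] by blast
  have "((\<lambda>\<beta>. LINT x|M. ?f x * chi (?y x) \<beta>) has_sum
    (LINT x|M. ?f x * (\<Prod>a\<in>UNIV. 1 / (1 - x $ a / q $ a)))) UNIV"
    using AE_msupp[OF M(2)] r by (intro has_sum_integral_chi[OF M _ C r(1,2)]) auto
  then have "((\<lambda>\<beta>. ?c * (LINT x|M. ?f x * chi (?y x) \<beta>)) has_sum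
    (?c * (LINT x|M. ?f x * (\<Prod>a\<in>UNIV. 1 / (1 - x $ a / q $ a))))) UNIV"
    by (rule has_sum_cmult_right)
  also have "(\<lambda>\<beta>. ?c * (LINT x|M. ?f x * chi (?y x) \<beta>)) = (\<lambda>\<beta>. moment_matrix M q m \<alpha> \<beta> * chi_star q \<beta>)"
  proof
    fix \<beta>
    have "chi (?y x) \<beta> = chi x \<beta> * chi (\<chi> a. inverse (q $ a)) \<beta>" for x
      by (simp add: chi_def divide_inverse power_mult_distrib prod.distrib)
    then show "?c * (LINT x|M. ?f x * chi (?y x) \<beta>) = moment_matrix M q m \<alpha> \<beta> * chi_star q \<beta>"
      by (simp add: moment_matrix_weight chi_star_def flip: mult.assoc)
  qed
  also have "?c * (LINT x|M. ?f x * (\<Prod>a\<in>UNIV. 1 / (1 - x $ a / q $ a))) =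
    (LINT x|M. ?c * (?f x * (\<Prod>a\<in>UNIV. 1 / (1 - x $ a / q $ a))))"
    by simp
  also have "\<dots> = (LINT x|M. (- 1) ^ CARD('d) * (weight q (m - (\<Sum>j\<in>UNIV. axis j 1)) x * (chi x \<alpha> * chi x 0)))"
  proof (rule integral_cong_AE)
    show "AE x in M. ?c * (?f x * (\<Prod>a\<in>UNIV. 1 / (1 - x $ a / q $ a))) =
      (- 1) ^ CARD('d) * (weight q (m - (\<Sum>j\<in>UNIV. axis j 1)) x * (chi x \<alpha> * chi x 0))"
      using AE_msupp[OF M(2)]
    proof eventually_elim
      case (elim x)
      have ne: "x $ a \<noteq> q $ a" for a
        using elim by (rule msupp_neq[OF supp])
      have "?c * (\<Prod>a\<in>UNIV. 1 / (1 - x $ a / q $ a)) = (\<Prod>a\<in>UNIV. - 1 * (1 / (x $ a - q $ a)))"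
        unfolding prod.distrib[symmetric] using q ne
        by (intro prod.cong) (auto simp: divide_simps dest: sym)
      also have "\<dots> = (- 1) ^ CARD('d) * (\<Prod>a\<in>UNIV. 1 / (x $ a - q $ a))"
        by (subst prod.distrib) simp
      finally have "?c * (\<Prod>a\<in>UNIV. 1 / (1 - x $ a / q $ a)) = (- 1) ^ CARD('d) * (\<Prod>a\<in>UNIV. 1 / (x $ a - q $ a))" .
      then show ?case
        by (simp add: weight_diff_all[OF ne] mult_ac)
    qed
  qed simp_all
  also have "\<dots> = (- 1) ^ CARD('d) * moment_matrix M q (m - (\<Sum>j\<in>UNIV. axis j 1)) \<alpha> 0"
    by (simp add: moment_matrix_weight)
  finally show ?thesis .
qed

subsection \<open>Iterated translations\<close>

text \<open>The \<open>Tr a\<close> inside \<open>rho\<close> cancels the translation at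
  \<open>a\<close> in the inverted factor. This is the passage between the two forms of the final
  formula.\<close>

lemma rho_shift_eq:
  "rho_shift H a k m = Tinv {a..} (Hblk H k) m \<odot> mtrans (blk (k - 1) k (Lam a))
    \<odot> blk_inv (k - 1) (Tinv {a<..} (Hblk H (k - 1)) m)"
proof -
  have "{a..} = insert a {a<..}"
    by auto
  then have "m - (\<Sum>j\<in>{a..}. axis j 1) + axis a 1 = m - (\<Sum>j\<in>{a<..}. axis j 1)"
    by simp
  then show ?thesis
    by (simp only: rho_shift_def rho_def Tinv_def Tr_def)
qed

section \<open>Sums over weakly increasing tuples and telescoping in the coordinates\<close>

lemma desc_prod_cong:
  "(\<And>j. 0 < j \<Longrightarrow> j \<le> k \<Longrightarrow> F j = F' j) \<Longrightarrow> desc_prod F k B = desc_prod F' k B"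
  by (induction k) simp_all

lemma finite_weakly_increasing: "finite (weakly_increasing k :: 'd::{finite,linorder} list set)"
  using finite_lists_length_eq[of "UNIV :: 'd set" k]
  by (rule finite_subset[rotated]) (auto simp: weakly_increasing_def)

text \<open>Splits off the last, hence largest, entry \<open>a\<close>. The remaining entries are
  bounded by \<open>a\<close>, and downward closure of \<open>B\<close> places them in
  \<open>B\<close>.\<close>

lemma sum_weakly_increasing_Suc:
  fixes B :: "'d::{finite,linorder} set"
  assumes "\<And>a b. a \<in> B \<Longrightarrow> b \<le> a \<Longrightarrow> b \<in> B"
  shows "(\<Sum>as | as \<in> weakly_increasing (Suc k) \<and> set as \<subseteq> B. f as) =
    (\<Sum>a\<in>B. \<Sum>as | as \<in> weakly_increasing k \<and> set as \<subseteq> {..a}. f (as @ [a]))"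
proof -
  let ?W = "\<lambda>a. {as. as \<in> weakly_increasing k \<and> set as \<subseteq> {..a}}"
  have "(\<Sum>a\<in>B. \<Sum>as\<in>?W a. f (as @ [a])) = (\<Sum>(a, as)\<in>Sigma B ?W. f (as @ [a]))"
    by (rule sum.Sigma) (auto intro: finite_subset[OF _ finite_weakly_increasing])
  also have "\<dots> = (\<Sum>as | as \<in> weakly_increasing (Suc k) \<and> set as \<subseteq> B. f as)"
  proof (rule sum.reindex_bij_witness[where i = "\<lambda>as. (last as, butlast as)" and j = "\<lambda>(a, as). as @ [a]"])
    fix as :: "'d list"
    assume as: "as \<in> {as. as \<in> weakly_increasing (Suc k) \<and> set as \<subseteq> B}"
    then obtain bs a where [simp]: "as = bs @ [a]"
      by (cases as rule: rev_cases) (auto simp: weakly_increasing_def)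
    show "(case (last as, butlast as) of (a, as) \<Rightarrow> as @ [a]) = as"
      by simp
    show "(last as, butlast as) \<in> Sigma B ?W"
      using as by (auto simp: weakly_increasing_def sorted_append)
  qed (auto simp: weakly_increasing_def sorted_append intro: assms)
  finally show ?thesis ..
qed

text \<open>The two translated lattice points differ by \<open>axis a 1\<close>, so the connection
  formula applies to them.\<close>

lemma Tinv_shift_step:
  fixes G S H :: "int ^ 'd::{finite,linorder} \<Rightarrow> 'd smat"
  assumes fact: "\<And>n. block_factorization (G n) (S n) (H n)"
    and G: "\<And>n a \<alpha> \<beta>. G (n + axis a 1) \<alpha> \<beta> = G n \<alpha> (\<beta> + axis a 1) - q $ a * G n \<alpha> \<beta>"
    and "\<alpha> \<in> level k" "k > 0"
  shows "(Tinv {a..} S m \<odot> A) \<alpha> \<gamma> = (Tinv {a<..} S m \<odot> A) \<alpha> \<gamma> +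
    (rho_shift H a k m \<odot> (Tinv {a<..} S m \<odot> A)) \<alpha> \<gamma>"
proof -
  have "{a..} = insert a {a<..}"
    by auto
  then have n: "m - (\<Sum>j\<in>{a<..}. axis j 1) = m - (\<Sum>j\<in>{a..}. axis j 1) + axis a 1"
    by simp
  show ?thesis
    unfolding rho_shift_eq Tinv_def Hblk_def blk_inv_blk
    by (rule block_factorization_shift[OF fact fact _ assms(3,4)]) (simp only: n G)
qed

text \<open>\<open>B\<close> is an initial segment holding the coordinates still to be lowered, the
  largest first. Just after \<open>a\<close> is removed the untranslated coordinate set is
  \<open>{x. x < a}\<close>, while the \<rho> term involves the state just before, with lowered
  coordinates \<open>- {..a}\<close>.\<close>

lemma Tinv_telescope:
  fixes G S H :: "int ^ 'd::{finite,linorder} \<Rightarrow> 'd smat"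
  assumes fact: "\<And>n. block_factorization (G n) (S n) (H n)"
    and G: "\<And>n a \<alpha> \<beta>. G (n + axis a 1) \<alpha> \<beta> = G n \<alpha> (\<beta> + axis a 1) - q $ a * G n \<alpha> \<beta>"
    and \<alpha>: "\<alpha> \<in> level k" "k > 0"
    and B: "\<And>a b. a \<in> B \<Longrightarrow> b \<le> a \<Longrightarrow> b \<in> B"
  shows "(Tinv (- B) S m \<odot> A) \<alpha> \<gamma> = (Tinv UNIV S m \<odot> A) \<alpha> \<gamma> -
    (\<Sum>a\<in>B. (rho_shift H a k m \<odot> (Tinv (- {..a}) S m \<odot> A)) \<alpha> \<gamma>)"
  using finite[of B] B
proof (induction rule: finite_linorder_max_induct)
  case empty
  show ?case
    by simp
next
  case (insert b B)
  \<comment> \<open>As \<open>b\<close> exceeds all of \<open>B\<close> and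
    \<open>insert b B\<close> is downward closed, \<open>B\<close> consists of exactly the elements
    below \<open>b\<close>.\<close>
  have eq: "- B = {b..}" "- insert b B = {b<..}" "- {..b} = {b<..}"
    using insert.hyps(2) insert.prems[of b] by (auto simp: not_less not_le) (metis insertE leD linear)+
  have IH: "(Tinv (- B) S m \<odot> A) \<alpha> \<gamma> = (Tinv UNIV S m \<odot> A) \<alpha> \<gamma> -
    (\<Sum>a\<in>B. (rho_shift H a k m \<odot> (Tinv (- {..a}) S m \<odot> A)) \<alpha> \<gamma>)"
  proof (rule insert.IH)
    show "c \<in> B" if "a \<in> B" "c \<le> a" for a c
      using that insert.prems[of a c] insert.hyps(2) by auto
  qed
  have "b \<notin> B"
    using insert.hyps(2) by auto
  then show ?case
    using IH Tinv_shift_step[OF fact G \<alpha>, of b m A \<gamma>] insert.hyps(1) by (simp add: eq)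
qed

text \<open>The set \<open>B\<close> is general because the \<rho> term for \<open>a\<close> leaves
  \<open>S\<close> translated only in the coordinates above \<open>a\<close>: the induction
  hypothesis is then needed for \<open>{..a}\<close>, which bounds the earlier entries of the tuple
  by \<open>a\<close>. \<open>G\<close> stays fully translated throughout.\<close>

lemma Tinv_desc_prod:
  fixes G S H :: "int ^ 'd::{finite,linorder} \<Rightarrow> 'd smat"
  assumes fact: "\<And>n. block_factorization (G n) (S n) (H n)"
    and G: "\<And>n a \<alpha> \<beta>. G (n + axis a 1) \<alpha> \<beta> = G n \<alpha> (\<beta> + axis a 1) - q $ a * G n \<alpha> \<beta>"
    and "\<alpha> \<in> level k"
    and "\<And>a b. a \<in> B \<Longrightarrow> b \<le> a \<Longrightarrow> b \<in> B"
  shows "(Tinv (- B) S m \<odot> Tinv UNIV G m) \<alpha> 0 = (- 1) ^ k *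
    (\<Sum>as | as \<in> weakly_increasing k \<and> set as \<subseteq> B.
      desc_prod (\<lambda>j. rho_shift H (as ! (j - 1)) j m) k (Tinv UNIV (Hblk H 0) m) \<alpha> 0)"
  using assms(3,4)
proof (induction k arbitrary: \<alpha> B)
  case 0
  have diag: "(Tinv UNIV S m \<odot> Tinv UNIV G m) 0 0 = Tinv UNIV H m 0 0"
    unfolding Tinv_def by (intro block_factorization_mmul_lower[OF fact]) simp
  \<comment> \<open>Row 0 of every \<open>S n\<close> is that of the identity, so at level 0 the
    translation of \<open>S\<close> has no effect.\<close>
  have row: "(S n \<odot> X) 0 0 = X 0 0" for n X
  proof -
    have "S n 0 \<beta> = mone 0 \<beta>" for \<beta>
      using fact[of n] by (auto simp: block_factorization_def block_lower_unitriangular_def mdeg_def)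
    then have "(S n \<odot> X) 0 0 = (mone \<odot> X) 0 0"
      by (rule mmul_row_cong)
    then show ?thesis
      by simp
  qed
  have "{as. as \<in> weakly_increasing 0 \<and> set as \<subseteq> B} = {[]}"
    by (auto simp: weakly_increasing_def)
  moreover have "\<alpha> = 0"
    using 0 by (simp add: level_def mdeg_eq_0_iff)
  ultimately show ?case
    using diag by (simp add: Tinv_def row Hblk_def blk_def level_def mdeg_eq_0_iff)
next
  case (Suc k)
  let ?D = "\<lambda>as k. desc_prod (\<lambda>j. rho_shift H (as ! (j - 1)) j m) k (Tinv UNIV (Hblk H 0) m)"
  let ?W = "\<lambda>a. {as. as \<in> weakly_increasing k \<and> set as \<subseteq> {..a}}"
  \<comment> \<open>Once fully translated, \<open>S\<close> matches \<open>G\<close>, and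
    orthogonality to the constants applies because \<alpha> has positive degree.\<close>
  have zero: "(Tinv UNIV S m \<odot> Tinv UNIV G m) \<alpha> 0 = 0"
  proof -
    have "(Tinv UNIV S m \<odot> Tinv UNIV G m) \<alpha> 0 = Tinv UNIV H m \<alpha> 0"
      unfolding Tinv_def by (intro block_factorization_mmul_lower[OF fact]) (simp add: mdeg_def)
    moreover have "block_diagonal (Tinv UNIV H m)"
      using fact by (simp add: block_factorization_def Tinv_def)
    ultimately show ?thesis
      using Suc.prems(1) by (simp add: block_diagonal_def level_def mdeg_def)
  qed
  have fin: "finite (level k :: (nat ^ 'd::{finite,linorder}) set)"
    by (rule finite_subset[OF _ finite_mdeg_le[of k]]) (auto simp: level_def)
  have rho: "(rho_shift H a (Suc k) m \<odot> X) \<alpha> 0 =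
    (\<Sum>\<beta>\<in>level k. rho_shift H a (Suc k) m \<alpha> \<beta> * X \<beta> 0)" for a X
  proof (rule mmul_eq_sum[OF fin])
    fix \<beta> :: "nat ^ 'd::{finite,linorder}"
    assume "\<beta> \<notin> level k"
    moreover have "\<exists>B. is_blk_inv k (H n) B" for n
      using fact by (simp add: block_factorization_def)
    ultimately have "rho_shift H a (Suc k) m \<alpha> \<beta> = 0"
      by (simp add: rho_shift_eq Tinv_def Hblk_def blk_inv_blk mmul_def blk_inv_eq_0)
    then show "rho_shift H a (Suc k) m \<alpha> \<beta> * X \<beta> 0 = 0"
      by simp
  qed
  have step: "(rho_shift H a (Suc k) m \<odot> (Tinv (- {..a}) S m \<odot> Tinv UNIV G m)) \<alpha> 0 =
    (- 1) ^ k * (\<Sum>as\<in>?W a. ?D (as @ [a]) (Suc k) \<alpha> 0)" for a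
  proof -
    \<comment> \<open>The appended entry \<open>a\<close> has index \<open>k\<close> and enters only
      the outermost factor, numbered \<open>Suc k\<close>; the inner factors read
      \<open>as\<close>.\<close>
    have D: "?D (as @ [a]) (Suc k) = rho_shift H a (Suc k) m \<odot> ?D as k" if "as \<in> ?W a" for as
    proof -
      have "length as = k"
        using that by (simp add: weakly_increasing_def)
      then have "?D (as @ [a]) k = ?D as k"
        by (intro desc_prod_cong) (auto simp: nth_append)
      moreover have "(as @ [a]) ! k = a"
        using \<open>length as = k\<close> by (metis nth_append_length)
      ultimately show ?thesis
        by simp
    qed
    have "(rho_shift H a (Suc k) m \<odot> (Tinv (- {..a}) S m \<odot> Tinv UNIV G m)) \<alpha> 0 =
      (\<Sum>\<beta>\<in>level k. rho_shift H a (Suc k) m \<alpha> \<beta> * ((- 1) ^ k * (\<Sum>as\<in>?W a. ?D as k \<beta> 0)))"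
      unfolding rho by (intro sum.cong refl arg_cong2[where f = "(*)"] Suc.IH) auto
    also have "\<dots> = (- 1) ^ k * (\<Sum>\<beta>\<in>level k. \<Sum>as\<in>?W a. rho_shift H a (Suc k) m \<alpha> \<beta> * ?D as k \<beta> 0)"
      by (simp add: sum_distrib_left mult.left_commute)
    also have "\<dots> = (- 1) ^ k * (\<Sum>as\<in>?W a. (rho_shift H a (Suc k) m \<odot> ?D as k) \<alpha> 0)"
      unfolding rho by (subst sum.swap) simp
    also have "\<dots> = (- 1) ^ k * (\<Sum>as\<in>?W a. ?D (as @ [a]) (Suc k) \<alpha> 0)"
      by (intro arg_cong2[where f = "(*)"] sum.cong refl) (simp only: D)
    finally show ?thesis .
  qed
  have "(Tinv (- B) S m \<odot> Tinv UNIV G m) \<alpha> 0 =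
    - (\<Sum>a\<in>B. (- 1) ^ k * (\<Sum>as\<in>?W a. ?D (as @ [a]) (Suc k) \<alpha> 0))"
  proof -
    have "(Tinv (- B) S m \<odot> Tinv UNIV G m) \<alpha> 0 = (Tinv UNIV S m \<odot> Tinv UNIV G m) \<alpha> 0 -
      (\<Sum>a\<in>B. (rho_shift H a (Suc k) m \<odot> (Tinv (- {..a}) S m \<odot> Tinv UNIV G m)) \<alpha> 0)"
      by (rule Tinv_telescope[OF fact G Suc.prems(1) zero_less_Suc Suc.prems(2)])
    then show ?thesis
      unfolding step zero by simp
  qed
  also have "\<dots> = (- 1) ^ Suc k * (\<Sum>a\<in>B. \<Sum>as\<in>?W a. ?D (as @ [a]) (Suc k) \<alpha> 0)"
    by (simp add: sum_distrib_left[symmetric])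
  also have "(\<Sum>a\<in>B. \<Sum>as\<in>?W a. ?D (as @ [a]) (Suc k) \<alpha> 0) =
    (\<Sum>as | as \<in> weakly_increasing (Suc k) \<and> set as \<subseteq> B. ?D as (Suc k) \<alpha> 0)"
    by (rule sum_weakly_increasing_Suc[symmetric]) (rule Suc.prems(2))
  finally show ?case .
qed

section \<open>The value of the second kind functions at \<open>q\<close>\<close>

lemma has_sum_second_kind_term:
  fixes M :: "(real ^ 'd::finite) measure"
  assumes M: "finite_measure M" "sets M = sets borel" and supp: "msupp M \<subseteq> {x. \<forall>a. \<bar>x $ a\<bar> < \<bar>q $ a\<bar>}"
    and q: "\<And>a. q $ a \<noteq> 0"
    and fact: "block_factorization (moment_matrix M q m) S H"
  shows "(second_kind_term S H q \<alpha> has_sum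
    ((- 1) ^ CARD('d) * (S \<odot> Tinv UNIV (moment_matrix M q) m) \<alpha> 0)) UNIV"
proof -
  let ?G = "moment_matrix M q m" and ?G' = "Tinv UNIV (moment_matrix M q) m"
  let ?F = "{\<gamma>. S \<alpha> \<gamma> \<noteq> 0}"
  have rf: "row_finite S"
    using fact block_lower_unitriangular_row_finite by (auto simp: block_factorization_def)
  \<comment> \<open>Row \<alpha> of \<open>S\<close> is finite, so the series is a finite
    combination of the Cauchy kernel series for the rows of the moment matrix; convergence and value
    come together.\<close>
  have "((\<lambda>\<beta>. \<Sum>\<gamma>\<in>F. S \<alpha> \<gamma> * (?G \<gamma> \<beta> * chi_star q \<beta>)) has_sum
    (\<Sum>\<gamma>\<in>F. S \<alpha> \<gamma> * ((- 1) ^ CARD('d) * ?G' \<gamma> 0))) UNIV" if "finite F" for F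
    using that
  proof induction
    case (insert \<gamma> F)
    then show ?case
      using has_sum_moment_matrix_chi_star[OF M supp q, of m \<gamma>]
      by (simp add: Tinv_def has_sum_add has_sum_cmult_right)
  qed simp
  from this[of ?F] have "((\<lambda>\<beta>. \<Sum>\<gamma>\<in>?F. S \<alpha> \<gamma> * (?G \<gamma> \<beta> * chi_star q \<beta>)) has_sum
    (\<Sum>\<gamma>\<in>?F. S \<alpha> \<gamma> * ((- 1) ^ CARD('d) * ?G' \<gamma> 0))) UNIV"
    using rf by (simp add: row_finite_def)
  also have "(\<lambda>\<beta>. \<Sum>\<gamma>\<in>?F. S \<alpha> \<gamma> * (?G \<gamma> \<beta> * chi_star q \<beta>)) = second_kind_term S H q \<alpha>"
    by (simp add: second_kind_term_def fun_eq_iff mmul_row_sum[OF rf] sum_distrib_right mult.assoc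
        flip: block_factorization_mmul_eq[OF fact])
  also have "(\<Sum>\<gamma>\<in>?F. S \<alpha> \<gamma> * ((- 1) ^ CARD('d) * ?G' \<gamma> 0)) = (- 1) ^ CARD('d) * (S \<odot> ?G') \<alpha> 0"
    by (simp add: mmul_row_sum[OF rf] sum_distrib_left mult.left_commute)
  finally show ?thesis .
qed

theorem theorem3p2p2:
  fixes M :: "(real ^ 'd::{finite,linorder}) measure"
    and q :: "real ^ 'd::{finite,linorder}"
    and S H :: "int ^ 'd::{finite,linorder} \<Rightarrow> 'd smat"
    and m :: "int ^ 'd::{finite,linorder}"
    and k :: nat
    and \<alpha> :: "nat ^ 'd::{finite,linorder}"
  assumes q_nonzero: "\<And>a. q $ a \<noteq> 0"
    and borel_measure: "sets M = sets borel"
    and finite_moments: "\<And>\<beta>. integrable M (\<lambda>x. chi x \<beta>)"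
    and support: "msupp M \<subseteq> {x. \<forall>a. \<bar>x $ a\<bar> < \<bar>q $ a\<bar>}"
    and factorization: "\<And>n. block_factorization (moment_matrix M q n) (S n) (H n)"
    and level: "\<alpha> \<in> level k"
  shows "second_kind_term (S m) (H m) q \<alpha> summable_on UNIV \<and>
    second_kind (S m) (H m) q \<alpha> =
      (- 1) ^ (k + CARD('d)) *
      (\<Sum>as\<in>weakly_increasing k.
        desc_prod (\<lambda>j. rho_shift H (as ! (j - 1)) j m) k (Tinv UNIV (Hblk H 0) m) \<alpha> 0) \<and>
    second_kind (S m) (H m) q \<alpha> =
      (- 1) ^ (k + CARD('d)) *
      (\<Sum>as\<in>weakly_increasing k.
        desc_prod (\<lambda>j.
            Tinv {as ! (j - 1)..} (Hblk H j) m
            \<odot> mtrans (blk (j - 1) j (Lam (as ! (j - 1))))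
            \<odot> blk_inv (j - 1) (Tinv {as ! (j - 1)<..} (Hblk H (j - 1)) m))
          k (Tinv UNIV (Hblk H 0) m) \<alpha> 0)"
proof -
  let ?G = "moment_matrix M q"
  let ?R = "\<Sum>as\<in>weakly_increasing k.
    desc_prod (\<lambda>j. rho_shift H (as ! (j - 1)) j m) k (Tinv UNIV (Hblk H 0) m) \<alpha> 0"
  \<comment> \<open>The monomial of degree 0 is 1, so the finite moment of order 0 is finiteness of
    the measure.\<close>
  have M: "finite_measure M"
    using finite_moments[of 0] by (intro finite_measureI) (auto simp: integrable_iff_bounded)
  have G: "?G (n + axis a 1) \<beta> \<gamma> = ?G n \<beta> (\<gamma> + axis a 1) - q $ a * ?G n \<beta> \<gamma>" for n a \<beta> \<gamma>
    by (rule moment_matrix_add_axis[OF M borel_measure support])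
  have "(S m \<odot> Tinv UNIV ?G m) \<alpha> 0 = (- 1) ^ k * ?R"
    using Tinv_desc_prod[where B = UNIV, OF factorization G level, of m] by (simp add: Tinv_empty)
  then have "(second_kind_term (S m) (H m) q \<alpha> has_sum (- 1) ^ (k + CARD('d)) * ?R) UNIV"
    using has_sum_second_kind_term[OF M borel_measure support q_nonzero factorization, of m \<alpha>]
    by (simp add: power_add mult_ac)
  then have "second_kind_term (S m) (H m) q \<alpha> summable_on UNIV"
    "second_kind (S m) (H m) q \<alpha> = (- 1) ^ (k + CARD('d)) * ?R"
    by (simp_all add: has_sum_iff second_kind_def)
  then show ?thesis
    unfolding rho_shift_eq by blast
qed

end
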